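(* Let $n\ge 2$ and $1\le d\le n-1$ be integers, and let $K,C\subseteq\mathbb{R}^n$ be compact convex sets, where $C$ is $d$-decomposable. Suppose that, for each $d$-dimensional linear subspace $\xi\subseteq\mathbb{R}^n$, there exists $w\in\xi$ such that $K_\xi+w\subseteq C_\xi$. Then there exists $v\in\mathbb{R}^n$ such that $K+v\subseteq C$.
   Context: All compact convex sets are nonempty. For a linear subspace $\xi$ of $\mathbb{R}^n$, $K_\xi$ denotes the orthogonal projection of $K$ onto $\xi$. A compact convex set $C\subseteq\mathbb{R}^n$ is $d$-decomposable if there exist a direct sum decomposition into linear subspaces $\mathbb{R}^n=\xi_1\oplus\cdots\oplus\xi_m$ with $\dim\xi_i\le d$ for each $i$, and compact convex sets $C_i\subseteq\xi_i$, such that $C=C_1+\cdots+C_m$ (Minkowski sum). *)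

theory Defs
  imports "HOL-Analysis.Analysis"
begin

definition orth_proj :: "'a::euclidean_space set \<Rightarrow> 'a \<Rightarrow> 'a"
  where "orth_proj S x = (THE y. y \<in> S \<and> (\<forall>z\<in>S. orthogonal (x - y) z))"

lemma orth_proj_ex1:
  fixes S :: "'a::euclidean_space set"
  assumes "subspace S"
  shows "\<exists>!y. y \<in> S \<and> (\<forall>z\<in>S. orthogonal (x - y) z)"
proof (rule ex_ex1I)
  obtain y z where "y \<in> span S" and "\<And>w. w \<in> span S \<Longrightarrow> orthogonal z w" and "x = y + z"
    using orthogonal_subspace_decomp_exists[of S x] by metis
  then show "\<exists>y. y \<in> S \<and> (\<forall>z\<in>S. orthogonal (x - y) z)"
    using assms by (intro exI[of _ y]) (simp add: span_eq_iff[THEN iffD2])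
next
  fix y y'
  assume y: "y \<in> S \<and> (\<forall>z\<in>S. orthogonal (x - y) z)"
    and y': "y' \<in> S \<and> (\<forall>z\<in>S. orthogonal (x - y') z)"
  then have "y - y' \<in> S"
    using assms by (simp add: subspace_diff)
  then have "orthogonal (x - y) (y - y')" "orthogonal (x - y') (y - y')"
    using y y' by blast+
  then have "(y - y') \<bullet> (y - y') = 0"
    by (simp add: orthogonal_def inner_diff_left)
  then show "y = y'"
    by simp
qed

lemma orth_proj_in: "subspace S \<Longrightarrow> orth_proj S x \<in> S"
  and orth_proj_orthogonal: "subspace S \<Longrightarrow> z \<in> S \<Longrightarrow> orthogonal (x - orth_proj S x) z"
  using theI'[OF orth_proj_ex1[of S x]] unfolding orth_proj_def by blast+

text \<open>
  Internal direct sum of subspaces: every vector is uniquely a sum of components, one in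
  each summand. The extensional product makes a family of components indexed by
  \<open>{1..m}\<close> a unique function. Zero summands are allowed.
\<close>

definition direct_sum_decomposition :: "nat \<Rightarrow> (nat \<Rightarrow> 'a::euclidean_space set) \<Rightarrow> bool"
  where "direct_sum_decomposition m \<xi> \<longleftrightarrow>
    (\<forall>i\<in>{1..m}. subspace (\<xi> i)) \<and>
    (\<forall>x. \<exists>!f. f \<in> (\<Pi>\<^sub>E i\<in>{1..m}. \<xi> i) \<and> x = (\<Sum>i=1..m. f i))"

text \<open>
  The sum of sets below is the Minkowski sum of \<open>HOL-Library.Set_Algebras\<close>. Compact convex
  sets are nonempty by convention.
\<close>

definition decomposable :: "nat \<Rightarrow> 'a::euclidean_space set \<Rightarrow> bool"
  where "decomposable d C \<longleftrightarrow>
    (\<exists>m \<xi> D. direct_sum_decomposition m \<xi> \<and>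
       (\<forall>i\<in>{1..m}. dim (\<xi> i) \<le> d) \<and>
       (\<forall>i\<in>{1..m}. compact (D i) \<and> convex (D i) \<and> D i \<noteq> {} \<and> D i \<subseteq> \<xi> i) \<and>
       C = (\<Sum>i=1..m. D i))"

end

(* Each projection p onto a summand along the others has rank at most d, so it factors through
   the orthogonal projection onto some d-dimensional subspace. Hence p K is, up to a translation
   within the summand, contained in p C, which is the corresponding summand of C. Adding up the
   translation vectors over all summands moves K into C. *)
theory Submission
  imports Defs
begin

definition direct_sum_component :: "nat \<Rightarrow> (nat \<Rightarrow> 'a::euclidean_space set) \<Rightarrow> 'a \<Rightarrow> nat \<Rightarrow> 'a"
  where "direct_sum_component m \<xi> x = (THE f. f \<in> (\<Pi>\<^sub>E i\<in>{1..m}. \<xi> i) \<and> x = (\<Sum>i=1..m. f i))"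

lemma direct_sum_component:
  assumes "direct_sum_decomposition m \<xi>"
  shows direct_sum_component_in: "i \<in> {1..m} \<Longrightarrow> direct_sum_component m \<xi> x i \<in> \<xi> i"
    and sum_direct_sum_component: "(\<Sum>i=1..m. direct_sum_component m \<xi> x i) = x"
proof -
  have "\<exists>!f. f \<in> (\<Pi>\<^sub>E i\<in>{1..m}. \<xi> i) \<and> x = (\<Sum>i=1..m. f i)"
    using assms unfolding direct_sum_decomposition_def by blast
  from theI'[OF this]
  have *: "direct_sum_component m \<xi> x \<in> (\<Pi>\<^sub>E i\<in>{1..m}. \<xi> i) \<and>
      x = (\<Sum>i=1..m. direct_sum_component m \<xi> x i)"
    unfolding direct_sum_component_def .
  then show "i \<in> {1..m} \<Longrightarrow> direct_sum_component m \<xi> x i \<in> \<xi> i"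
    by (auto dest: PiE_mem)
  from * show "(\<Sum>i=1..m. direct_sum_component m \<xi> x i) = x"
    by simp
qed

text \<open>This turns uniqueness of the decomposition into a rule for computing components: any
  family with members in the summands and the right total gives them. Values of \<open>g\<close>
  outside \<open>{1..m}\<close> are left free, so callers need not supply an extensional
  function.\<close>

lemma direct_sum_component_eq:
  assumes dec: "direct_sum_decomposition m \<xi>"
    and g: "\<And>i. i \<in> {1..m} \<Longrightarrow> g i \<in> \<xi> i" and x: "x = (\<Sum>i=1..m. g i)" and i: "i \<in> {1..m}"
  shows "direct_sum_component m \<xi> x i = g i"
proof -
  have ex1: "\<exists>!f. f \<in> (\<Pi>\<^sub>E i\<in>{1..m}. \<xi> i) \<and> x = (\<Sum>i=1..m. f i)"
    using dec unfolding direct_sum_decomposition_def by blast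
  have "restrict g {1..m} \<in> (\<Pi>\<^sub>E i\<in>{1..m}. \<xi> i) \<and> x = (\<Sum>i=1..m. restrict g {1..m} i)"
    using g x by auto
  then have "direct_sum_component m \<xi> x = restrict g {1..m}"
    unfolding direct_sum_component_def by (rule the1_equality[OF ex1])
  then show ?thesis
    using i by simp
qed

text \<open>Adding or scaling the components of vectors stays inside the subspaces
  \<open>\<xi> j\<close> and yields the right total, so uniqueness identifies the result.\<close>

lemma linear_direct_sum_component:
  assumes dec: "direct_sum_decomposition m \<xi>" and i: "i \<in> {1..m}"
  shows "linear (\<lambda>x. direct_sum_component m \<xi> x i)"
proof -
  have sub: "subspace (\<xi> j)" if "j \<in> {1..m}" for j
    using dec that unfolding direct_sum_decomposition_def by blast
  note comp = direct_sum_component[OF dec, simplified]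
  show ?thesis
  proof (rule linearI)
    fix x y
    show "direct_sum_component m \<xi> (x + y) i
        = direct_sum_component m \<xi> x i + direct_sum_component m \<xi> y i"
      by (rule direct_sum_component_eq
          [where g = "\<lambda>j. direct_sum_component m \<xi> x j + direct_sum_component m \<xi> y j", OF dec _ _ i])
        (simp_all add: subspace_add sub comp sum.distrib)
  next
    fix r x
    show "direct_sum_component m \<xi> (r *\<^sub>R x) i = r *\<^sub>R direct_sum_component m \<xi> x i"
      by (rule direct_sum_component_eq
          [where g = "\<lambda>j. r *\<^sub>R direct_sum_component m \<xi> x j", OF dec _ _ i])
        (simp_all add: subspace_scale sub comp flip: scaleR_sum_right)
  qed
qed

text \<open>Take \<open>S\<close> to be the orthogonal complement of a subspace \<open>M\<close> of
  the kernel of \<open>p\<close>. Then \<open>x - orth_proj S x\<close> lies in \<open>M\<close>, so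
  \<open>p\<close> does not see the difference. The dimension of \<open>S\<close> must be exactly
  \<open>d\<close>, even if the rank is smaller, because the hypothesis on projections concerns only
  \<open>d\<close>-dimensional subspaces.\<close>

lemma linear_factors_through_orth_proj:
  fixes p :: "'a::euclidean_space \<Rightarrow> 'b::euclidean_space"
  assumes p: "linear p" and rank: "dim (range p) \<le> d" and d: "d \<le> DIM('a)"
  obtains S where "subspace S" "dim S = d" "\<And>x. p (orth_proj S x) = p x"
proof -
  define N where "N = {x. p x = 0}"
  have N: "subspace N"
    unfolding N_def using p by (rule linear_subspace_kernel)
  define N' where "N' = N\<^sup>\<bottom>"
  have N': "subspace N'"
    unfolding N'_def by (rule subspace_orthogonal_comp)
  have dim_comp: "dim (M\<^sup>\<bottom>) + dim M = DIM('a)" if "subspace M" for M :: "'a set"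
    using dim_subspace_orthogonal_to_vectors[of M UNIV] that by (simp add: orthogonal_comp_def)
  \<comment> \<open>Injectivity on the complement of the kernel bounds \<open>dim N'\<close> by the
    rank, hence by \<open>d\<close>; this is the rank-nullity estimate for
    \<open>dim N\<close>.\<close>
  have "inj_on p N'"
  proof (rule inj_onI)
    fix x y assume "x \<in> N'" "y \<in> N'" "p x = p y"
    then have "x - y \<in> N'" "x - y \<in> N"
      using N' by (auto simp: subspace_diff N_def linear_diff[OF p])
    then show "x = y"
      by (auto simp: N'_def orthogonal_comp_def orthogonal_self)
  qed
  then have "dim (p ` N') = dim N'"
    using N' by (intro dim_image_eq p) (simp add: span_eq_iff[THEN iffD2])
  moreover have "dim (p ` N') \<le> dim (range p)"
    by (intro dim_subset) auto
  ultimately have "DIM('a) - d \<le> dim N"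
    using dim_comp[OF N] rank by (simp add: N'_def)
  \<comment> \<open>The kernel may have dimension greater than \<open>DIM('a) - d\<close>; cutting
    it down to \<open>M\<close> makes the complement have dimension \<open>d\<close>.\<close>
  then obtain M where M: "subspace M" "M \<subseteq> span N" "dim M = DIM('a) - d"
    by (rule choose_subspace_of_subspace)
  have MN: "M \<subseteq> N"
    using M(2) N by (simp add: span_eq_iff[THEN iffD2])
  show thesis
  proof
    show S: "subspace (M\<^sup>\<bottom>)"
      by (rule subspace_orthogonal_comp)
    show "dim (M\<^sup>\<bottom>) = d"
      using dim_comp[OF M(1)] M(3) d by simp
    fix x
    have "x - orth_proj (M\<^sup>\<bottom>) x \<in> M\<^sup>\<bottom>\<^sup>\<bottom>"
      using orth_proj_orthogonal[OF S]
      by (subst orthogonal_comp_def) (simp add: orthogonal_commute)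
    then have "x - orth_proj (M\<^sup>\<bottom>) x \<in> N"
      using MN orthogonal_comp_self[OF M(1)] by auto
    then show "p (orth_proj (M\<^sup>\<bottom>) x) = p x"
      by (simp add: N_def linear_diff[OF p])
  qed
qed

theorem theorem2p3:
  fixes K C :: "(real ^ 'n) set" and d :: nat
  assumes "CARD('n) \<ge> 2"
    and "1 \<le> d" and "d \<le> CARD('n) - 1"
    and "compact K" and "convex K" and "K \<noteq> {}"
    and "compact C" and "convex C" and "C \<noteq> {}"
    and "decomposable d C"
    and "\<And>\<xi> :: (real ^ 'n) set. subspace \<xi> \<Longrightarrow> dim \<xi> = d \<Longrightarrow>
           \<exists>w\<in>\<xi>. (\<lambda>x. x + w) ` (orth_proj \<xi> ` K) \<subseteq> orth_proj \<xi> ` C"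
  shows "\<exists>v :: real ^ 'n. (\<lambda>x. x + v) ` K \<subseteq> C"
proof -
  obtain m \<xi> D where dec: "direct_sum_decomposition m \<xi>"
    and dim: "\<And>i. i \<in> {1..m} \<Longrightarrow> dim (\<xi> i) \<le> d"
    and D: "\<And>i. i \<in> {1..m} \<Longrightarrow> D i \<subseteq> \<xi> i"
    and C: "C = (\<Sum>i=1..m. D i)"
    using \<open>decomposable d C\<close> unfolding decomposable_def by blast
  define p where "p i x = direct_sum_component m \<xi> x i" for i x
  have C_eq: "C = {\<Sum>i=1..m. g i |g. \<forall>i\<in>{1..m}. g i \<in> D i}"
    unfolding C by (simp add: set_sum_alt)
  \<comment> \<open>A point of \<open>C\<close> is a sum of points of the \<open>D i\<close>, and
    since \<open>D i \<subseteq> \<xi> i\<close> these points are its components.\<close>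
  have pC: "p i c \<in> D i" if i: "i \<in> {1..m}" and "c \<in> C" for i c
  proof -
    obtain g where g: "c = (\<Sum>i=1..m. g i)" "\<And>i. i \<in> {1..m} \<Longrightarrow> g i \<in> D i"
      using \<open>c \<in> C\<close> unfolding C_eq by blast
    then have "p i c = g i"
      unfolding p_def using D by (intro direct_sum_component_eq[where g = g, OF dec _ _ i]) auto
    then show ?thesis
      using g i by simp
  qed
  have "\<exists>u. \<forall>x\<in>K. p i x + u \<in> D i" if i: "i \<in> {1..m}" for i
  proof -
    have lin: "linear (p i)"
      unfolding p_def by (rule linear_direct_sum_component[OF dec i])
    have "range (p i) \<subseteq> \<xi> i"
      using direct_sum_component_in[OF dec i] by (auto simp: p_def)
    then have "dim (range (p i)) \<le> d"
      using dim_subset dim[OF i] order_trans by blast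
    moreover have "d \<le> DIM(real ^ 'n)"
      using assms(3) by simp
    ultimately obtain S where S: "subspace S" "dim S = d" "\<And>x. p i (orth_proj S x) = p i x"
      using linear_factors_through_orth_proj[OF lin] by blast
    obtain w where w: "(\<lambda>x. x + w) ` (orth_proj S ` K) \<subseteq> orth_proj S ` C"
      using assms(11)[OF S(1,2)] by blast
    \<comment> \<open>Both \<open>S\<close> and \<open>w\<close> depend on \<open>i\<close>.
      Applying \<open>p i\<close> to an inclusion between projections onto \<open>S\<close> removes
      the projections, and \<open>p i w\<close> becomes the translation for this summand.\<close>
    have "p i x + p i w \<in> D i" if "x \<in> K" for x
    proof -
      have "orth_proj S x + w \<in> orth_proj S ` C"
        using w that by (simp add: image_subset_iff)
      then obtain c where "c \<in> C" and c: "orth_proj S x + w = orth_proj S c"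
        by (rule imageE)
      have "p i x + p i w = p i (orth_proj S x + w)"
        by (simp add: linear_add[OF lin] S(3))
      also have "\<dots> = p i c"
        by (simp add: c S(3))
      finally show ?thesis
        using pC[OF i \<open>c \<in> C\<close>] by simp
    qed
    then show ?thesis
      by blast
  qed
  then obtain u where u: "\<And>i x. i \<in> {1..m} \<Longrightarrow> x \<in> K \<Longrightarrow> p i x + u i \<in> D i"
    by metis
  \<comment> \<open>The points \<open>p i x + u i\<close> come from different
    \<open>c \<in> C\<close> for different \<open>i\<close>. This is harmless, as a Minkowski sum
    allows its summands to be chosen independently.\<close>
  have "x + (\<Sum>i=1..m. u i) \<in> C" if "x \<in> K" for x
  proof -
    have "x + (\<Sum>i=1..m. u i) = (\<Sum>i=1..m. p i x + u i)"
      unfolding sum.distrib p_def by (simp only: sum_direct_sum_component[OF dec])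
    then show ?thesis
      unfolding C_eq using u that by blast
  qed
  then show ?thesis
    by blast
qed

end
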